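(* Let $\mathcal{M}$ be a Riemannian manifold with a retraction $\mathrm{R}$, let $f\colon\mathcal{M}\to\mathbb{R}$ be twice continuously differentiable, let $x_0\in\mathcal{M}$ be arbitrary, and let $x_0,x_1,x_2,\ldots$ be the iterates (with trial steps $s_0,s_1,\ldots$ and pullbacks $\hat f_k=f\circ\mathrm{R}_{x_k}$) produced by the ARC algorithm (described in the context) with second-order progress enforced. Assume: (A1) there is a finite $f_{\mathrm{low}}$ with $f(x)\ge f_{\mathrm{low}}$ for all $x\in\mathcal{M}$; (A2) there is a constant $L$ such that at each iteration $k$, $\hat f_k(s_k)-\big[\hat f_k(0)+\langle s_k,\nabla\hat f_k(0)\rangle+\frac12\langle s_k,\nabla^2\hat f_k(0)[s_k]\rangle\big]\le\frac L6\|s_k\|^3$. Let $\varsigma_{\max}=\max\!\left(\varsigma_0,\frac{L\gamma_3}{2(1-\eta_2)}\right)$. Then for any $\varepsilon>0$, the total number of successful iterations $k$ such that $\lambda_{\min}(\nabla^2\hat f_k(0))<-\varepsilon$ is bounded above by $$K_2(\varepsilon)=\frac{3(f(x_0)-f_{\mathrm{low}})}{\eta_1\varsigma_{\min}}(\theta+2\varsigma_{\max})^3\frac1{\varepsilon^3}.$$ Furthermore, $\liminf_{k\to\infty}\lambda_{\min}(\nabla^2\hat f_k(0))\ge0$ (when the algorithm does not terminate, so that the sequence of iterates is infinite).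
   Context: Notation. $\mathrm{T}_x\mathcal{M}$ is the tangent space at $x$ with Riemannian inner product $\langle\cdot,\cdot\rangle$ and norm $\|\cdot\|$; $\mathrm{T}\mathcal{M}$ is the tangent bundle; $\nabla,\nabla^2$ are the usual gradient and Hessian of functions on the Euclidean space $\mathrm{T}_x\mathcal{M}$; $\lambda_{\min}$ is the smallest eigenvalue of a self-adjoint operator. A retraction is a smooth map $\mathrm{R}\colon\mathrm{T}\mathcal{M}\to\mathcal{M}$, $(x,s)\mapsto\mathrm{R}_x(s)$, such that for each $x$, $\mathrm{R}_x(0)=x$ and $\mathrm{D}\mathrm{R}_x(0)$ is the identity on $\mathrm{T}_x\mathcal{M}$. ARC algorithm with retraction $\mathrm{R}$ and second-order progress enforced. Parameters: $\theta>0$, $\varsigma_{\min}>0$, $0<\eta_1\le\eta_2<1$, $0<\gamma_1<1<\gamma_2<\gamma_3$. Input: $x_0\in\mathcal{M}$, $\varsigma_0\ge\varsigma_{\min}$. For $k=0,1,2,\ldots$: let $\hat f_k=f\circ\mathrm{R}_{x_k}\colon\mathrm{T}_{x_k}\mathcal{M}\to\mathbb{R}$ and define $m_k(s)=\hat f_k(0)+\langle s,\nabla\hat f_k(0)\rangle+\frac12\langle s,\nabla^2\hat f_k(0)[s]\rangle+\frac{\varsigma_k}{3}\|s\|^3$. A subproblem solver returns any $s_k\in\mathrm{T}_{x_k}\mathcal{M}$ satisfying $m_k(s_k)\le m_k(0)$, $\|\nabla m_k(s_k)\|\le\theta\|s_k\|^2$, and (second-order progress) $\lambda_{\min}(\nabla^2m_k(s_k))\ge-\theta\|s_k\|$.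 If $s_k=0$, terminate. Otherwise compute $\rho_k=\dfrac{f(x_k)-f(\mathrm{R}_{x_k}(s_k))}{m_k(0)-m_k(s_k)+\frac{\varsigma_k}{3}\|s_k\|^3}$. If $\rho_k\ge\eta_1$ (iteration $k$ is successful), set $x_{k+1}=\mathrm{R}_{x_k}(s_k)$; otherwise (unsuccessful) set $x_{k+1}=x_k$. Choose $\varsigma_{k+1}\in[\max(\varsigma_{\min},\gamma_1\varsigma_k),\varsigma_k]$ if $\rho_k\ge\eta_2$; $\varsigma_{k+1}\in[\varsigma_k,\gamma_2\varsigma_k]$ if $\rho_k\in[\eta_1,\eta_2)$; $\varsigma_{k+1}\in[\gamma_2\varsigma_k,\gamma_3\varsigma_k]$ if $\rho_k<\eta_1$. *)

theory Defs
  imports "HOL-Analysis.Analysis"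
begin

section \<open>Smooth manifolds, given by an atlas\<close>

text \<open>
  For an open set \<open>S\<close> of a Euclidean space, \<open>Ck_on k S f\<close> says that \<open>f\<close> is \<open>k\<close> times
  continuously differentiable on \<open>S\<close>; in finite dimension it suffices to iterate the directional
  derivatives.
\<close>

fun Ck_on :: "nat \<Rightarrow> 'a::euclidean_space set \<Rightarrow> ('a \<Rightarrow> 'b::euclidean_space) \<Rightarrow> bool" where
  "Ck_on 0 S f \<longleftrightarrow> continuous_on S f"
| "Ck_on (Suc k) S f \<longleftrightarrow>
     f differentiable_on S \<and> (\<forall>v. Ck_on k S (\<lambda>x. frechet_derivative f (at x) v))"

definition smooth_on :: "'a::euclidean_space set \<Rightarrow> ('a \<Rightarrow> 'b::euclidean_space) \<Rightarrow> bool" where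
  "smooth_on S f \<longleftrightarrow> (\<forall>k. Ck_on k S f)"

text \<open>A chart is a pair of its domain and the coordinate map (relevant on the domain only).\<close>

type_synonym ('m, 'e) chart = "'m set \<times> ('m \<Rightarrow> 'e)"

definition chart_inv :: "('m, 'e) chart \<Rightarrow> 'e \<Rightarrow> 'm" where
  "chart_inv c = inv_into (fst c) (snd c)"

text \<open>
  The manifold is the whole type \<open>'m\<close>, modelled on the Euclidean space \<open>'e\<close>.  The type class
  constraints supply that it is Hausdorff and second countable.
\<close>

definition smooth_atlas ::
  "('m::{t2_space, second_countable_topology}, 'e::euclidean_space) chart set \<Rightarrow> bool" where
  "smooth_atlas A \<longleftrightarrow>
     (\<forall>c\<in>A. open (fst c) \<and> open (snd c ` fst c) \<and>
            homeomorphism (fst c) (snd c ` fst c) (snd c) (chart_inv c)) \<and>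
     (\<Union>c\<in>A. fst c) = UNIV \<and>
     (\<forall>c\<in>A. \<forall>d\<in>A. smooth_on (snd c ` (fst c \<inter> fst d)) (snd d \<circ> chart_inv c))"

text \<open>
  Maps of class \<open>C\<^sup>k\<close> between manifolds with atlases \<open>A\<close> and \<open>B\<close>.  Openness of the set where the
  coordinate expression is defined expresses continuity of \<open>F\<close>.  Only the charts are used, not the
  topology carried by the types: this matters below for the tangent bundle.
\<close>

definition Ck_map ::
  "nat \<Rightarrow> ('m, 'a::euclidean_space) chart set \<Rightarrow> ('n, 'b::euclidean_space) chart set \<Rightarrow> ('m \<Rightarrow> 'n) \<Rightarrow> bool"
  where
  "Ck_map k A B F \<longleftrightarrow>
     (\<forall>c\<in>A. \<forall>d\<in>B. let W = snd c ` (fst c \<inter> F -` fst d) in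
        open W \<and> Ck_on k W (snd d \<circ> F \<circ> chart_inv c))"

definition smooth_map ::
  "('m, 'a::euclidean_space) chart set \<Rightarrow> ('n, 'b::euclidean_space) chart set \<Rightarrow> ('m \<Rightarrow> 'n) \<Rightarrow> bool"
  where
  "smooth_map A B F \<longleftrightarrow> (\<forall>k. Ck_map k A B F)"

definition euclidean_atlas :: "('a::euclidean_space, 'a) chart set" where
  "euclidean_atlas = {(UNIV, id)}"


section \<open>Tangent spaces, tangent bundle, Riemannian metrics, retractions\<close>

text \<open>
  Every point \<open>x\<close> gets a preferred chart \<open>pc x\<close> around it, and \<open>T\<^sub>x M\<close> is the vector space \<open>'e\<close> of
  coordinate vectors with respect to \<open>pc x\<close>.  In any other chart \<open>c\<close> around \<open>x\<close>, the tangent vector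
  \<open>v\<close> has the coordinates \<open>coord_change (pc x) c x v\<close>.
\<close>

definition preferred_charts ::
  "('m, 'e) chart set \<Rightarrow> ('m \<Rightarrow> ('m, 'e) chart) \<Rightarrow> bool" where
  "preferred_charts A pc \<longleftrightarrow> (\<forall>x. pc x \<in> A \<and> x \<in> fst (pc x))"

definition coord_change ::
  "('m, 'e::euclidean_space) chart \<Rightarrow> ('m, 'e) chart \<Rightarrow> 'm \<Rightarrow> 'e \<Rightarrow> 'e" where
  "coord_change c d x = frechet_derivative (snd d \<circ> chart_inv c) (at (snd c x))"

text \<open>
  Points of the tangent bundle are pairs \<open>(x, v)\<close> with \<open>v\<close> in \<open>T\<^sub>x M\<close>.  Its smooth structure is
  the usual one induced by the charts of the base; its topology is in general not the product
  topology of the type \<open>'m \<times> 'e\<close>, since \<open>pc\<close> may jump.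
\<close>

definition tangent_atlas ::
  "('m, 'e::euclidean_space) chart set \<Rightarrow> ('m \<Rightarrow> ('m, 'e) chart) \<Rightarrow> ('m \<times> 'e, 'e \<times> 'e) chart set" where
  "tangent_atlas A pc =
     (\<lambda>c. (fst c \<times> UNIV, \<lambda>(x, v). (snd c x, coord_change (pc x) c x v))) ` A"

definition inner_product :: "('e::real_vector \<Rightarrow> 'e \<Rightarrow> real) \<Rightarrow> bool" where
  "inner_product p \<longleftrightarrow>
     (\<forall>u. linear (p u)) \<and> (\<forall>u v. p u v = p v u) \<and> (\<forall>u. u \<noteq> 0 \<longrightarrow> p u u > 0)"

definition riemannian_metric ::
  "('m, 'e::euclidean_space) chart set \<Rightarrow> ('m \<Rightarrow> ('m, 'e) chart) \<Rightarrow> ('m \<Rightarrow> 'e \<Rightarrow> 'e \<Rightarrow> real) \<Rightarrow> bool"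
  where
  "riemannian_metric A pc g \<longleftrightarrow>
     (\<forall>x. inner_product (g x)) \<and>
     (\<forall>c\<in>A. \<forall>u v. smooth_on (snd c ` fst c)
        (\<lambda>y. let x = chart_inv c y in
           g x (coord_change c (pc x) x u) (coord_change c (pc x) x v)))"

definition riemannian_manifold ::
  "('m::{t2_space, second_countable_topology}, 'e::euclidean_space) chart set \<Rightarrow>
   ('m \<Rightarrow> ('m, 'e) chart) \<Rightarrow> ('m \<Rightarrow> 'e \<Rightarrow> 'e \<Rightarrow> real) \<Rightarrow> bool" where
  "riemannian_manifold A pc g \<longleftrightarrow>
     smooth_atlas A \<and> preferred_charts A pc \<and> riemannian_metric A pc g"

text \<open>
  Since \<open>R x 0 = x\<close>, the differential at \<open>0\<close> of \<open>R x\<close> takes values in \<open>T\<^sub>x M\<close>, so it is computed in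
  the chart \<open>pc x\<close>.
\<close>

definition manifold_retraction ::
  "('m, 'e::euclidean_space) chart set \<Rightarrow> ('m \<Rightarrow> ('m, 'e) chart) \<Rightarrow> ('m \<Rightarrow> 'e \<Rightarrow> 'm) \<Rightarrow> bool" where
  "manifold_retraction A pc R \<longleftrightarrow>
     smooth_map (tangent_atlas A pc) A (\<lambda>(x, v). R x v) \<and>
     (\<forall>x. R x 0 = x) \<and>
     (\<forall>x. ((snd (pc x) \<circ> R x) has_derivative (\<lambda>v. v)) (at 0))"


section \<open>Calculus on a tangent space with its own inner product\<close>

text \<open>
  Here \<open>p\<close> is an inner product on \<open>'e\<close>, in general different from \<open>(\<bullet>)\<close>.  The norm that
  is implicit in the derivatives is the one of \<open>'e\<close>; this is immaterial as all norms on \<open>'e\<close> are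
  equivalent.
\<close>

definition ip_norm :: "('e \<Rightarrow> 'e \<Rightarrow> real) \<Rightarrow> 'e \<Rightarrow> real" where
  "ip_norm p v = sqrt (p v v)"

definition gradient ::
  "('e::euclidean_space \<Rightarrow> 'e \<Rightarrow> real) \<Rightarrow> ('e \<Rightarrow> real) \<Rightarrow> 'e \<Rightarrow> 'e" where
  "gradient p h s = (THE G. (h has_derivative (\<lambda>v. p G v)) (at s))"

definition hessian ::
  "('e::euclidean_space \<Rightarrow> 'e \<Rightarrow> real) \<Rightarrow> ('e \<Rightarrow> real) \<Rightarrow> 'e \<Rightarrow> 'e \<Rightarrow> 'e" where
  "hessian p h s = frechet_derivative (gradient p h) (at s)"

text \<open>The set of eigenvalues is finite, and nonempty if \<open>T\<close> is self-adjoint for some inner product.\<close>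

definition lambda_min :: "('e::real_vector \<Rightarrow> 'e) \<Rightarrow> real" where
  "lambda_min T = Min {l. \<exists>v. v \<noteq> 0 \<and> T v = l *\<^sub>R v}"


section \<open>The ARC algorithm\<close>

definition pullback :: "('m \<Rightarrow> real) \<Rightarrow> ('m \<Rightarrow> 'e \<Rightarrow> 'm) \<Rightarrow> 'm \<Rightarrow> 'e \<Rightarrow> real" where
  "pullback f R x = f \<circ> R x"

definition taylor2 ::
  "('e::euclidean_space \<Rightarrow> 'e \<Rightarrow> real) \<Rightarrow> ('e \<Rightarrow> real) \<Rightarrow> 'e \<Rightarrow> real" where
  "taylor2 p h s = h 0 + p s (gradient p h 0) + 1 / 2 * p s (hessian p h 0 s)"

definition cubic_model ::
  "('e::euclidean_space \<Rightarrow> 'e \<Rightarrow> real) \<Rightarrow> ('e \<Rightarrow> real) \<Rightarrow> real \<Rightarrow> 'e \<Rightarrow> real" where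
  "cubic_model p h \<sigma> s = taylor2 p h s + \<sigma> / 3 * ip_norm p s ^ 3"

definition subproblem_step ::
  "('e::euclidean_space \<Rightarrow> 'e \<Rightarrow> real) \<Rightarrow> real \<Rightarrow> ('e \<Rightarrow> real) \<Rightarrow> 'e \<Rightarrow> bool" where
  "subproblem_step p \<theta> m s \<longleftrightarrow>
     m s \<le> m 0 \<and>
     ip_norm p (gradient p m s) \<le> \<theta> * (ip_norm p s)\<^sup>2 \<and>
     lambda_min (hessian p m s) \<ge> - \<theta> * ip_norm p s"

definition arc_ratio ::
  "('m \<Rightarrow> 'e::euclidean_space \<Rightarrow> 'e \<Rightarrow> real) \<Rightarrow> ('m \<Rightarrow> 'e \<Rightarrow> 'm) \<Rightarrow> ('m \<Rightarrow> real) \<Rightarrow>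
   'm \<Rightarrow> 'e \<Rightarrow> real \<Rightarrow> real" where
  "arc_ratio g R f x s \<sigma> =
     (let m = cubic_model (g x) (pullback f R x) \<sigma> in
        (f x - f (R x s)) / (m 0 - m s + \<sigma> / 3 * ip_norm (g x) s ^ 3))"

text \<open>
  A run is given by total sequences.  Iteration \<open>k\<close> is carried out only if none of the previous ones
  has terminated the algorithm; entries that the algorithm does not produce are unconstrained.
\<close>

definition arc_reached :: "(nat \<Rightarrow> 'e::zero) \<Rightarrow> nat \<Rightarrow> bool" where
  "arc_reached s k \<longleftrightarrow> (\<forall>j<k. s j \<noteq> 0)"

definition arc_run ::
  "('m \<Rightarrow> 'e::euclidean_space \<Rightarrow> 'e \<Rightarrow> real) \<Rightarrow> ('m \<Rightarrow> 'e \<Rightarrow> 'm) \<Rightarrow> ('m \<Rightarrow> real) \<Rightarrow>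
   real \<Rightarrow> real \<Rightarrow> real \<Rightarrow> real \<Rightarrow> real \<Rightarrow> real \<Rightarrow> real \<Rightarrow>
   (nat \<Rightarrow> 'm) \<Rightarrow> (nat \<Rightarrow> 'e) \<Rightarrow> (nat \<Rightarrow> real) \<Rightarrow> bool" where
  "arc_run g R f \<theta> \<sigma>min \<eta>1 \<eta>2 \<gamma>1 \<gamma>2 \<gamma>3 x s \<sigma> \<longleftrightarrow>
     \<sigma> 0 \<ge> \<sigma>min \<and>
     (\<forall>k. arc_reached s k \<longrightarrow>
        subproblem_step (g (x k)) \<theta> (cubic_model (g (x k)) (pullback f R (x k)) (\<sigma> k)) (s k) \<and>
        (s k \<noteq> 0 \<longrightarrow>
           (let \<rho> = arc_ratio g R f (x k) (s k) (\<sigma> k) in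
              x (Suc k) = (if \<rho> \<ge> \<eta>1 then R (x k) (s k) else x k) \<and>
              (\<rho> \<ge> \<eta>2 \<longrightarrow> \<sigma> (Suc k) \<in> {max \<sigma>min (\<gamma>1 * \<sigma> k) .. \<sigma> k}) \<and>
              (\<eta>1 \<le> \<rho> \<and> \<rho> < \<eta>2 \<longrightarrow> \<sigma> (Suc k) \<in> {\<sigma> k .. \<gamma>2 * \<sigma> k}) \<and>
              (\<rho> < \<eta>1 \<longrightarrow> \<sigma> (Suc k) \<in> {\<gamma>2 * \<sigma> k .. \<gamma>3 * \<sigma> k}))))"

definition arc_successful ::
  "('m \<Rightarrow> 'e::euclidean_space \<Rightarrow> 'e \<Rightarrow> real) \<Rightarrow> ('m \<Rightarrow> 'e \<Rightarrow> 'm) \<Rightarrow> ('m \<Rightarrow> real) \<Rightarrow> real \<Rightarrow>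
   (nat \<Rightarrow> 'm) \<Rightarrow> (nat \<Rightarrow> 'e) \<Rightarrow> (nat \<Rightarrow> real) \<Rightarrow> nat \<Rightarrow> bool" where
  "arc_successful g R f \<eta>1 x s \<sigma> k \<longleftrightarrow>
     arc_reached s k \<and> s k \<noteq> 0 \<and> arc_ratio g R f (x k) (s k) (\<sigma> k) \<ge> \<eta>1"

end

theory Submission
  imports Defs
begin

text \<open>
  The Hessian of the model at a nonzero step \<open>s\<close> is \<open>H\<close>, the Hessian of the pullback at \<open>0\<close>, plus
  \<open>\<sigma> (\<parallel>s\<parallel> I + s s\<^sup>T / \<parallel>s\<parallel>)\<close>, whose largest eigenvalue is \<open>2 \<sigma> \<parallel>s\<parallel>\<close>.  Testing the second-order
  condition on an eigenvector of \<open>H\<close> therefore gives \<open>\<lambda>\<^sub>m\<^sub>i\<^sub>n H \<ge> - (\<theta> + 2 \<sigma>) \<parallel>s\<parallel>\<close>: strong negative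
  curvature forces a long step.  By (A2) iterations with \<open>\<sigma> \<ge> L / (2 (1 - \<eta>2))\<close> have ratio at
  least \<open>\<eta>2\<close>, so \<open>\<sigma>\<close> never exceeds \<open>\<sigma>max\<close>, while every successful step decreases \<open>f\<close> by at
  least \<open>\<eta>1 \<sigma>min \<parallel>s\<parallel>\<^sup>3 / 3\<close>; (A1) bounds the number of long successful steps.  For the limit,
  boundedness of \<open>\<sigma>\<close> forces infinitely many successes, and the iterate, hence \<open>\<lambda>\<^sub>m\<^sub>i\<^sub>n H\<close>, does not
  change until the next one.
\<close>

section \<open>Symmetry of the second derivative\<close>

text \<open>The mean value theorem along \<open>u\<close>, applied to the first difference along
  \<open>v\<close>, turns the second difference into a difference of two values of
  \<open>h' _ u\<close>. Both are then linearised at \<open>x\<close>, so second-order information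
  is used at the single point \<open>x\<close> only.\<close>

lemma second_difference_estimate:
  fixes h :: "'a::real_normed_vector \<Rightarrow> real"
  assumes S: "open S" "x \<in> S"
    and h: "\<And>y. y \<in> S \<Longrightarrow> (h has_derivative h' y) (at y)"
    and h': "((\<lambda>y. h' y u) has_derivative (\<lambda>w. h'' w u)) (at x)"
    and "\<epsilon> > 0"
  shows "\<exists>d>0. \<forall>t. 0 < t \<and> t < d \<longrightarrow>
           \<bar>(h (x + t *\<^sub>R u + t *\<^sub>R v) - h (x + t *\<^sub>R u) - h (x + t *\<^sub>R v) + h x) - t\<^sup>2 * h'' v u\<bar>
             \<le> \<epsilon> * t\<^sup>2"
proof -
  \<comment> \<open>All points of the parallelogram spanned by \<open>t *\<^sub>R u\<close> and
    \<open>t *\<^sub>R v\<close> lie within \<open>t * M\<close> of \<open>x\<close>; the summand 1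
    keeps \<open>M\<close> positive when \<open>u = v = 0\<close>.\<close>
  define M where "M = norm u + norm v + 1"
  have M: "M > 0" by (simp add: M_def add_nonneg_pos)
  \<comment> \<open>Two linearisation errors of size \<open>e * (t * M) = t * \<epsilon> / 2\<close>
    will add up to \<open>t * \<epsilon>\<close>.\<close>
  define e where "e = \<epsilon> / (2 * M)"
  have e: "e > 0" using M \<open>\<epsilon> > 0\<close> by (simp add: e_def)
  interpret D: bounded_linear "\<lambda>w. h'' w u" using h' by (rule has_derivative_bounded_linear)
  obtain d1 where d1: "d1 > 0"
    and lin: "\<And>y. norm (y - x) < d1 \<Longrightarrow> \<bar>h' y u - h' x u - h'' (y - x) u\<bar> \<le> e * norm (y - x)"
    using h' e unfolding has_derivative_at_alt by (metis real_norm_def)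
  obtain d2 where d2: "d2 > 0" and ball: "ball x d2 \<subseteq> S"
    using S open_contains_ball by blast
  define d where "d = min d1 d2 / M"
  show ?thesis
  proof (intro exI[of _ d] conjI allI impI)
    show "d > 0" using d1 d2 M by (simp add: d_def)
    fix t :: real assume t: "0 < t \<and> t < d"
    have tM: "t * M < d1" "t * M < d2" using t M by (simp_all add: d_def field_simps)
    have small: "norm (\<xi> *\<^sub>R u + \<tau> *\<^sub>R v) \<le> t * M" if "0 \<le> \<xi>" "\<xi> \<le> t" "0 \<le> \<tau>" "\<tau> \<le> t" for \<xi> \<tau>
    proof -
      have "norm (\<xi> *\<^sub>R u + \<tau> *\<^sub>R v) \<le> \<xi> * norm u + \<tau> * norm v"
        using that norm_triangle_ineq[of "\<xi> *\<^sub>R u" "\<tau> *\<^sub>R v"] by simp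
      also have "\<dots> \<le> t * norm u + t * norm v"
        using that by (intro add_mono mult_right_mono) auto
      also have "\<dots> \<le> t * M" using t by (simp add: M_def algebra_simps)
      finally show ?thesis .
    qed
    have inS: "x + (\<xi> *\<^sub>R u + \<tau> *\<^sub>R v) \<in> S" if "0 \<le> \<xi>" "\<xi> \<le> t" "0 \<le> \<tau>" "\<tau> \<le> t" for \<xi> \<tau>
    proof -
      have "norm (\<xi> *\<^sub>R u + \<tau> *\<^sub>R v) < d2" using small[OF that] tM by simp
      then have "x + (\<xi> *\<^sub>R u + \<tau> *\<^sub>R v) \<in> ball x d2"
        by (simp only: mem_ball dist_commute[of x]) (simp add: dist_norm)
      then show ?thesis using ball by blast
    qed
    \<comment> \<open>\<open>\<phi> t - \<phi> 0\<close> is the second difference. The term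
      \<open>0 *\<^sub>R v\<close> is kept so that both summands are instances of one family, at
      \<tau> = t and \<tau> = 0.\<close>
    define \<phi> where "\<phi> \<xi> = h (x + (\<xi> *\<^sub>R u + t *\<^sub>R v)) - h (x + (\<xi> *\<^sub>R u + 0 *\<^sub>R v))" for \<xi>
    define \<psi> where "\<psi> \<xi> = h' (x + (\<xi> *\<^sub>R u + t *\<^sub>R v)) u - h' (x + (\<xi> *\<^sub>R u + 0 *\<^sub>R v)) u" for \<xi>
    have der: "(\<phi> has_real_derivative \<psi> \<xi>) (at \<xi>)" if "0 \<le> \<xi>" "\<xi> \<le> t" for \<xi>
    proof -
      have part: "((\<lambda>\<xi>. h (x + (\<xi> *\<^sub>R u + \<tau> *\<^sub>R v))) has_derivative
              (\<lambda>r. h' (x + (\<xi> *\<^sub>R u + \<tau> *\<^sub>R v)) (r *\<^sub>R u))) (at \<xi>)" if "0 \<le> \<tau>" "\<tau> \<le> t" for \<tau>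
        by (rule has_derivative_compose[where f = "\<lambda>\<xi>. x + (\<xi> *\<^sub>R u + \<tau> *\<^sub>R v)" and g = h])
           (auto intro!: derivative_eq_intros h inS that \<open>0 \<le> \<xi>\<close> \<open>\<xi> \<le> t\<close>)
      have hom: "h' (x + (\<xi> *\<^sub>R u + \<tau> *\<^sub>R v)) (r *\<^sub>R u) = h' (x + (\<xi> *\<^sub>R u + \<tau> *\<^sub>R v)) u * r"
        if "0 \<le> \<tau>" "\<tau> \<le> t" for \<tau> r
        using has_derivative_linear[OF h[OF inS[OF \<open>0 \<le> \<xi>\<close> \<open>\<xi> \<le> t\<close> that]]]
        by (simp add: linear_cmul)
      have "(\<phi> has_derivative (\<lambda>r. \<psi> \<xi> * r)) (at \<xi>)"
        unfolding \<phi>_def \<psi>_def left_diff_distrib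
        using has_derivative_diff[OF part[of t] part[of 0]] t hom[of t] hom[of 0] by simp
      then show ?thesis by (simp add: has_field_derivative_def)
    qed
    obtain \<xi> where \<xi>: "0 < \<xi>" "\<xi> < t" and mvt: "\<phi> t - \<phi> 0 = t * \<psi> \<xi>"
      using MVT2[of 0 t \<phi> \<psi>] der t by auto
    have *: "\<bar>h' (x + (\<xi> *\<^sub>R u + \<tau> *\<^sub>R v)) u - h' x u - h'' (\<xi> *\<^sub>R u + \<tau> *\<^sub>R v) u\<bar> \<le> e * (t * M)"
      if "0 \<le> \<tau>" "\<tau> \<le> t" for \<tau>
    proof -
      have n: "norm (\<xi> *\<^sub>R u + \<tau> *\<^sub>R v) \<le> t * M" using small that \<xi> by simp
      then have "\<bar>h' (x + (\<xi> *\<^sub>R u + \<tau> *\<^sub>R v)) u - h' x u - h'' (\<xi> *\<^sub>R u + \<tau> *\<^sub>R v) u\<bar>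
          \<le> e * norm (\<xi> *\<^sub>R u + \<tau> *\<^sub>R v)"
        using lin[of "x + (\<xi> *\<^sub>R u + \<tau> *\<^sub>R v)"] tM by simp
      also have "\<dots> \<le> e * (t * M)" using n e by simp
      finally show ?thesis .
    qed
    have eM: "e * (t * M) = t * \<epsilon> / 2" using M by (simp add: e_def)
    have "h'' (\<xi> *\<^sub>R u + t *\<^sub>R v) u - h'' (\<xi> *\<^sub>R u + 0 *\<^sub>R v) u = t * h'' v u"
      by (simp add: D.add D.scaleR)
    then have "\<bar>\<psi> \<xi> - t * h'' v u\<bar> \<le> t * \<epsilon>"
      using *[of t] *[of 0] t unfolding \<psi>_def eM by linarith
    then have "t * \<bar>\<psi> \<xi> - t * h'' v u\<bar> \<le> t * (t * \<epsilon>)"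
      using t by (intro mult_left_mono) auto
    moreover have "t * \<bar>\<psi> \<xi> - t * h'' v u\<bar> = \<bar>(\<phi> t - \<phi> 0) - t\<^sup>2 * h'' v u\<bar>"
    proof -
      have "(\<phi> t - \<phi> 0) - t\<^sup>2 * h'' v u = t * (\<psi> \<xi> - t * h'' v u)"
        by (simp add: mvt power2_eq_square right_diff_distrib)
      then show ?thesis using t by (simp add: abs_mult)
    qed
    moreover have "\<phi> t - \<phi> 0 = h (x + t *\<^sub>R u + t *\<^sub>R v) - h (x + t *\<^sub>R u) - h (x + t *\<^sub>R v) + h x"
      by (simp add: \<phi>_def add.assoc)
    ultimately show "\<bar>(h (x + t *\<^sub>R u + t *\<^sub>R v) - h (x + t *\<^sub>R u) - h (x + t *\<^sub>R v) + h x)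
        - t\<^sup>2 * h'' v u\<bar> \<le> \<epsilon> * t\<^sup>2"
      by (simp add: power2_eq_square mult_ac)
  qed
qed

text \<open>The second difference does not change when \<open>u\<close> and \<open>v\<close> are
  swapped, while its two estimates have leading terms \<open>h'' v u\<close> and
  \<open>h'' u v\<close>.\<close>

lemma second_derivative_symmetric:
  fixes h :: "'a::real_normed_vector \<Rightarrow> real"
  assumes S: "open S" "x \<in> S"
    and h: "\<And>y. y \<in> S \<Longrightarrow> (h has_derivative h' y) (at y)"
    and h': "\<And>v. ((\<lambda>y. h' y v) has_derivative (\<lambda>w. h'' w v)) (at x)"
  shows "h'' u v = h'' v u"
proof -
  have "\<bar>h'' u v - h'' v u\<bar> \<le> 0 + e" if e: "e > 0" for e
  proof -
    obtain d1 d2 where d: "d1 > 0" "d2 > 0"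
      and d1: "\<And>t. 0 < t \<Longrightarrow> t < d1 \<Longrightarrow>
         \<bar>(h (x + t *\<^sub>R u + t *\<^sub>R v) - h (x + t *\<^sub>R u) - h (x + t *\<^sub>R v) + h x) - t\<^sup>2 * h'' v u\<bar> \<le> e / 2 * t\<^sup>2"
      and d2: "\<And>t. 0 < t \<Longrightarrow> t < d2 \<Longrightarrow>
         \<bar>(h (x + t *\<^sub>R v + t *\<^sub>R u) - h (x + t *\<^sub>R v) - h (x + t *\<^sub>R u) + h x) - t\<^sup>2 * h'' u v\<bar> \<le> e / 2 * t\<^sup>2"
      using second_difference_estimate[OF S h h', where \<epsilon> = "e / 2" and u = u and v = v]
        second_difference_estimate[OF S h h', where \<epsilon> = "e / 2" and u = v and v = u] e by auto
    obtain t where t: "0 < t" "t < d1" "t < d2" using d by (metis field_lbound_gt_zero)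
    have "x + t *\<^sub>R v + t *\<^sub>R u = x + t *\<^sub>R u + t *\<^sub>R v" by (simp add: add_ac)
    with d1[OF t(1,2)] d2[OF t(1,3)] have "\<bar>t\<^sup>2 * h'' u v - t\<^sup>2 * h'' v u\<bar> \<le> e * t\<^sup>2"
      by (simp only: abs_le_iff) (linarith)
    then have "t\<^sup>2 * \<bar>h'' u v - h'' v u\<bar> \<le> t\<^sup>2 * e"
      by (metis abs_mult abs_power2 mult.commute right_diff_distrib)
    then show ?thesis using t by simp
  qed
  then have "\<bar>h'' u v - h'' v u\<bar> \<le> 0" by (rule field_le_epsilon)
  then show ?thesis by simp
qed

section \<open>Inner products, gradients and smallest eigenvalues\<close>

locale inner_product_space =
  fixes p :: "'e::euclidean_space \<Rightarrow> 'e \<Rightarrow> real"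
  assumes inner_product: "inner_product p"
begin

lemma linear_right: "linear (p u)" and commute: "p u v = p v u"
  using inner_product by (auto simp: inner_product_def)

lemma linear_left: "linear (\<lambda>u. p u v)"
  by (subst commute) (rule linear_right)

lemma bounded_bilinear: "bounded_bilinear p"
  using linear_left linear_right by (simp add: bilinear_def flip: bilinear_conv_bounded_bilinear)

text \<open>Provides the algebraic, continuity and product rules of bounded bilinear maps for
  \<open>p\<close>.\<close>

sublocale bounded_bilinear p
  by (rule bounded_bilinear)

lemma pos: "u \<noteq> 0 \<Longrightarrow> p u u > 0"
  using inner_product by (auto simp: inner_product_def)

lemma self_eq_0_iff [simp]: "p u u = 0 \<longleftrightarrow> u = 0"
  using pos[of u] zero_left[of u] by fastforce

lemma self_nonneg [simp]: "p u u \<ge> 0"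
  using pos[of u] by (cases "u = 0") (auto simp: zero_left)

lemma eqI: "u = w" if "\<And>v. p u v = p w v"
  using that[of "u - w"] self_eq_0_iff[of "u - w"] by (simp add: diff_left del: self_eq_0_iff)

lemma ip_norm_sq: "(ip_norm p u)\<^sup>2 = p u u"
  and ip_norm_eq_0_iff [simp]: "ip_norm p u = 0 \<longleftrightarrow> u = 0"
  by (simp_all add: ip_norm_def)

lemma ip_norm_pos: "u \<noteq> 0 \<Longrightarrow> ip_norm p u > 0"
  by (simp add: ip_norm_def pos)

text \<open>\<open>K\<close> inverts the Gram map \<open>J\<close>, which is injective by
  definiteness and hence bijective in finite dimension. One linear \<open>K\<close> serves all
  points, so a \<open>p\<close>-gradient is a fixed linear image of the Euclidean gradient.\<close>

lemma riesz: obtains K where "linear K" "\<And>a v. p (K a) v = a \<bullet> v"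
proof -
  define J where "J u = (\<Sum>b\<in>Basis. p u b *\<^sub>R b)" for u
  have J: "J u \<bullet> v = p u v" for u v
  proof -
    have "p u v = p u (\<Sum>b\<in>Basis. (v \<bullet> b) *\<^sub>R b)" by (simp add: euclidean_representation)
    also have "\<dots> = J u \<bullet> v"
      by (simp add: J_def sum_right scaleR_right inner_sum_left inner_commute[of v] mult.commute)
    finally show ?thesis ..
  qed
  have lin: "linear J"
    by (rule linearI) (simp_all add: J_def add_left scaleR_left algebra_simps sum.distrib scaleR_sum_right)
  have inj: "inj J"
    by (metis J eqI injI)
  obtain K where K: "linear K" "\<And>a. J (K a) = a"
    using linear_injective_isomorphism[OF lin inj] by blast
  show ?thesis using that[OF K(1)] K(2) J by metis
qed

section \<open>Gradients and Hessians with respect to \<open>p\<close>\<close>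

lemma gradient_eqI: "gradient p h s = G" if "(h has_derivative p G) (at s)"
  unfolding gradient_def using that
  by (intro the_equality) (auto intro!: eqI dest: has_derivative_unique)

text \<open>The gradient is \<open>K\<close> applied to the vector of partial derivatives, so it is
  differentiable at \<open>x\<close>. Pairing its derivative with \<open>v\<close> gives the second
  derivative of \<open>h\<close>, whose symmetry is self-adjointness.\<close>

lemma hessian_selfadjoint:
  fixes h :: "'e \<Rightarrow> real"
  assumes S: "open S" "x \<in> S"
    and h: "\<And>y. y \<in> S \<Longrightarrow> (h has_derivative h' y) (at y)"
    and h': "\<And>v. (\<lambda>y. h' y v) differentiable (at x)"
  shows "linear (hessian p h x)" and "p (hessian p h x u) v = p u (hessian p h x v)"
proof -
  obtain K where K: "linear K" "\<And>a v. p (K a) v = a \<bullet> v" using riesz by blast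
  define G where "G y = K (\<Sum>b\<in>Basis. h' y b *\<^sub>R b)" for y
  have G: "p (G y) v = h' y v" if "y \<in> S" for y v
  proof -
    have "h' y v = h' y (\<Sum>b\<in>Basis. (v \<bullet> b) *\<^sub>R b)" by (simp add: euclidean_representation)
    also have "\<dots> = (\<Sum>b\<in>Basis. (v \<bullet> b) *\<^sub>R h' y b)"
      using has_derivative_linear[OF h[OF that]] by (simp add: linear_sum linear_cmul)
    finally show ?thesis
      by (simp add: G_def K inner_sum_left inner_commute[of v] mult.commute)
  qed
  have grad: "gradient p h y = G y" if "y \<in> S" for y
  proof (rule gradient_eqI)
    have "p (G y) = h' y" using G[OF that] by (rule ext)
    then show "(h has_derivative p (G y)) (at y)" using h[OF that] by simp
  qed
  define h'' where "h'' w v = frechet_derivative (\<lambda>y. h' y v) (at x) w" for w v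
  have h'': "((\<lambda>y. h' y v) has_derivative (\<lambda>w. h'' w v)) (at x)" for v
    using h'[of v] frechet_derivative_works unfolding h''_def by blast
  define H where "H w = K (\<Sum>b\<in>Basis. h'' w b *\<^sub>R b)" for w
  have "(G has_derivative H) (at x)"
    unfolding G_def H_def using K(1)
    by (intro bounded_linear.has_derivative[of K])
       (auto intro!: derivative_intros h'' simp: linear_linear)
  \<comment> \<open>\<open>gradient\<close> is a definite description, identified with
    \<open>G\<close> on \<open>S\<close> only; openness of \<open>S\<close> makes this enough for
    the derivative at \<open>x\<close>.\<close>
  then have dG: "(gradient p h has_derivative H) (at x)"
    by (rule has_derivative_transform_within_open[OF _ S]) (simp add: grad)
  then have hess: "hessian p h x = H"
    unfolding hessian_def by (metis frechet_derivative_at)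
  then show lin: "linear (hessian p h x)" using dG by (simp add: has_derivative_linear)
  have "((\<lambda>y. p (G y) v) has_derivative (\<lambda>w. p (H w) v)) (at x)" for v
    using \<open>(G has_derivative H) (at x)\<close>
    by (rule bounded_linear.has_derivative[OF bounded_linear_left])
  then have "((\<lambda>y. h' y v) has_derivative (\<lambda>w. p (H w) v)) (at x)" for v
    by (rule has_derivative_transform_within_open[OF _ S]) (simp add: G)
  then have "p (H u) v = p (H v) u"
    using second_derivative_symmetric[OF S h, where h'' = "\<lambda>w v. p (H w) v"] by blast
  then show "p (hessian p h x u) v = p u (hessian p h x v)"
    by (simp add: hess commute)
qed

section \<open>Smallest eigenvalue of a self-adjoint map\<close>

lemma Rayleigh_minimiser:
  assumes T: "linear T" and sa: "\<And>u v. p (T u) v = p u (T v)"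
  obtains v0 \<mu> where "v0 \<noteq> 0" "T v0 = \<mu> *\<^sub>R v0" "\<And>v. \<mu> * p v v \<le> p (T v) v"
proof -
  define q where "q v = p (T v) v / p v v" for v
  have bl: "bounded_linear T" using T by (simp add: linear_linear)
  \<comment> \<open>\<open>q\<close> is homogeneous of degree 0, so minimising over the compact
    Euclidean unit sphere minimises over all nonzero vectors, although the inner product is
    \<open>p\<close>.\<close>
  have "continuous_on (sphere 0 1) q"
    unfolding q_def
    by (intro continuous_on_divide continuous_on[of _ T "\<lambda>v. v"] continuous_on[of _ "\<lambda>v. v" "\<lambda>v. v"]
        continuous_on_id linear_continuous_on bl) auto
  moreover have "sphere (0::'e) 1 \<noteq> {}" by simp
  ultimately obtain v0 where v0: "norm v0 = 1" and min: "\<And>v. norm v = 1 \<Longrightarrow> q v0 \<le> q v"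
    using continuous_attains_inf[of "sphere 0 1" q] by auto
  define \<mu> where "\<mu> = q v0"
  have nz: "v0 \<noteq> 0" using v0 by auto
  have ray: "\<mu> * p v v \<le> p (T v) v" for v
  proof (cases "v = 0")
    case False
    have "q ((1 / norm v) *\<^sub>R v) = q v"
      using False by (simp add: q_def linear_cmul[OF T] scaleR_left scaleR_right)
    moreover have "norm ((1 / norm v) *\<^sub>R v) = 1" using False by simp
    ultimately have "\<mu> \<le> q v" using min \<mu>_def by metis
    then show ?thesis using pos[OF False] by (simp add: q_def field_simps)
  qed (simp add: zero_right)
  \<comment> \<open>The residual \<open>w\<close> of the eigenvalue equation is orthogonal to
    \<open>v0\<close>. Moving \<open>v0\<close> along \<open>w\<close> changes the nonnegative form
    \<open>p (T v) v - \<mu> * p v v\<close> to first order by \<open>2 * t * p w w\<close>, which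
    forces \<open>w = 0\<close>.\<close>
  define w where "w = T v0 - \<mu> *\<^sub>R v0"
  have w0: "p w v0 = 0"
    using pos[OF nz] nz by (simp add: w_def diff_left scaleR_left \<mu>_def q_def)
  define b where "b = p (T w) w - \<mu> * p w w"
  have quad: "0 \<le> 2 * t * p w w + t\<^sup>2 * b" for t
  proof -
    have "0 \<le> p (T (v0 + t *\<^sub>R w)) (v0 + t *\<^sub>R w) - \<mu> * p (v0 + t *\<^sub>R w) (v0 + t *\<^sub>R w)"
      using ray[of "v0 + t *\<^sub>R w"] by simp
    also have "\<dots> = (p (T v0) v0 - \<mu> * p v0 v0) + 2 * t * (p (T v0) w - \<mu> * p v0 w) + t\<^sup>2 * b"
      using sa[of w v0] commute[of w "T v0"] commute[of w v0]
      by (simp add: b_def linear_add[OF T] linear_cmul[OF T] add_left add_right scaleR_left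
          scaleR_right power2_eq_square algebra_simps)
    also have "p (T v0) v0 - \<mu> * p v0 v0 = p w v0"
      by (simp add: w_def diff_left scaleR_left)
    \<comment> \<open>The definition of \<open>w\<close> is unfolded in the first argument of
      \<open>p w w\<close> only.\<close>
    also have "p (T v0) w - \<mu> * p v0 w = p w w"
      by (simp add: diff_left scaleR_left w_def[THEN arg_cong, of "\<lambda>u. p u w"])
    finally show ?thesis using w0 by simp
  qed
  have "p w w = 0"
  proof (rule ccontr)
    assume "p w w \<noteq> 0"
    \<comment> \<open>With \<open>c\<close> positive and at least \<open>b\<close>, the choice
      \<open>t = - a / c\<close> minimises \<open>2 * t * a + t\<^sup>2 * c\<close>, with value
      \<open>- a\<^sup>2 / c\<close>.\<close>
    define a c where "a = p w w" and "c = \<bar>b\<bar> + 1"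
    have a: "a > 0" and c: "c > 0" "b \<le> c" using \<open>p w w \<noteq> 0\<close> pos[of w] by (auto simp: a_def c_def)
    have "0 \<le> 2 * (- a / c) * a + (- a / c)\<^sup>2 * b" using quad[of "- a / c"] by (simp add: a_def)
    also have "\<dots> \<le> 2 * (- a / c) * a + (- a / c)\<^sup>2 * c"
      using c by (intro add_left_mono mult_left_mono) auto
    also have "\<dots> = - a\<^sup>2 / c" using c by (simp add: field_simps power2_eq_square)
    also have "\<dots> < 0" using a c by simp
    finally show False by simp
  qed
  then have "T v0 = \<mu> *\<^sub>R v0" by (simp add: w_def)
  with nz ray that show ?thesis by blast
qed


text \<open>Needed for \<open>Min\<close> in \<open>lambda_min\<close> to be meaningful.
  Eigenvectors for distinct eigenvalues are \<open>p\<close>-orthogonal, hence independent, and an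
  independent set is finite here.\<close>

lemma finite_eigenvalues:
  assumes sa: "\<And>u v. p (T u) v = p u (T v)"
  shows "finite {l. \<exists>v. v \<noteq> 0 \<and> T v = l *\<^sub>R v}" (is "finite ?E")
proof -
  have "\<forall>l\<in>?E. \<exists>v. v \<noteq> 0 \<and> T v = l *\<^sub>R v" by blast
  from bchoice[OF this] obtain V where V: "\<And>l. l \<in> ?E \<Longrightarrow> V l \<noteq> 0 \<and> T (V l) = l *\<^sub>R V l"
    by blast
  have inj: "inj_on V ?E"
    by (rule inj_onI) (metis V scaleR_right_imp_eq)
  have orth: "p (V l) (V m) = 0" if "l \<in> ?E" "m \<in> ?E" "l \<noteq> m" for l m
    using sa[of "V l" "V m"] V[OF that(1)] V[OF that(2)] that(3)
    by (simp add: scaleR_left scaleR_right)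
  have "independent (V ` ?E)"
    unfolding independent_explicit_finite_subsets
  proof (intro allI impI ballI)
    fix S c v assume S: "S \<subseteq> V ` ?E" "finite S" "(\<Sum>v\<in>S. c v *\<^sub>R v) = 0" and v: "v \<in> S"
    have o: "p w v = 0" if w: "w \<in> S" "w \<noteq> v" for w
    proof -
      obtain l m where "l \<in> ?E" "w = V l" "m \<in> ?E" "v = V m"
        using subsetD[OF S(1) v] subsetD[OF S(1) w(1)] by (elim imageE)
      then show ?thesis using orth[of l m] w(2) by blast
    qed
    have "0 = p (\<Sum>w\<in>S. c w *\<^sub>R w) v" using S(3) by (simp add: zero_left)
    also have "\<dots> = (\<Sum>w\<in>S. c w * p w v)" by (simp add: sum_left scaleR_left)
    also have "\<dots> = (\<Sum>w\<in>S. if w = v then c v * p v v else 0)"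
      by (intro sum.cong) (auto simp: o)
    also have "\<dots> = c v * p v v" using S(2) v by simp
    finally have "c v * p v v = 0" ..
    moreover have "v \<noteq> 0" using subsetD[OF S(1) v] V by (elim imageE) simp
    ultimately show "c v = 0" by simp
  qed
  then have "finite (V ` ?E)" by (rule independent_imp_finite)
  then show ?thesis using inj by (rule finite_imageD)
qed

text \<open>Connects the definition by \<open>Min\<close> with the variational description: the
  minimum of the Rayleigh quotient is an eigenvalue and bounds every eigenvalue from below.\<close>

lemma lambda_min_selfadjoint:
  assumes T: "linear T" and sa: "\<And>u v. p (T u) v = p u (T v)"
  obtains v0 where "v0 \<noteq> 0" "T v0 = lambda_min T *\<^sub>R v0" "\<And>v. lambda_min T * p v v \<le> p (T v) v"
proof -
  obtain v0 \<mu> where v0: "v0 \<noteq> 0" "T v0 = \<mu> *\<^sub>R v0" and \<mu>: "\<And>v. \<mu> * p v v \<le> p (T v) v"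
    using Rayleigh_minimiser[OF assms] by blast
  have "lambda_min T = \<mu>"
    unfolding lambda_min_def
  proof (rule Min_eqI[OF finite_eigenvalues[OF sa]])
    fix l assume "l \<in> {l. \<exists>v. v \<noteq> 0 \<and> T v = l *\<^sub>R v}"
    then obtain v where "v \<noteq> 0" "T v = l *\<^sub>R v" by blast
    then show "\<mu> \<le> l" using \<mu>[of v] pos[of v] by (simp add: scaleR_left)
  qed (use v0 in blast)
  then show ?thesis using that v0 \<mu> by blast
qed

section \<open>Derivatives of the cubic model\<close>

lemma Cauchy_Schwarz: "(p u v)\<^sup>2 \<le> p u u * p v v"
proof (cases "u = 0")
  case False
  \<comment> \<open>The component of \<open>v\<close> orthogonal to \<open>u\<close>, scaled by
    \<open>p u u\<close> to avoid a division.\<close>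
  define w where "w = p u u *\<^sub>R v - p u v *\<^sub>R u"
  have "0 \<le> p w w" by simp
  also have "p w w = p u u * (p u u * p v v - (p u v)\<^sup>2)"
    by (simp add: w_def diff_left diff_right scaleR_left scaleR_right commute[of v u]
        power2_eq_square algebra_simps)
  finally show ?thesis using pos[OF False] by (simp add: zero_le_mult_iff)
qed (simp add: zero_left)

lemma ip_norm_has_derivative:
  assumes "s \<noteq> 0"
  shows "(ip_norm p has_derivative (\<lambda>w. p s w / ip_norm p s)) (at s)"
proof -
  have "((\<lambda>v. p v v) has_derivative (\<lambda>w. 2 * p s w)) (at s)"
    by (rule has_derivative_eq_rhs[OF FDERIV[OF has_derivative_ident has_derivative_ident]])
       (simp add: fun_eq_iff commute)
  from has_derivative_real_sqrt[OF pos[OF assms] this] show ?thesis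
    unfolding ip_norm_def[abs_def] by (rule has_derivative_eq_rhs) (simp add: fun_eq_iff divide_simps)
qed

text \<open>Self-adjointness makes \<open>H s\<close> the gradient of the quadratic part. The cubic
  part is differentiated through \<open>ip_norm\<close>, whence \<open>s \<noteq> 0\<close>.\<close>

lemma cubic_model_has_derivative:
  fixes h :: "'e \<Rightarrow> real" and \<sigma> :: real
  defines "H \<equiv> hessian p h 0"
  assumes H: "linear H" and sa: "\<And>u v. p (H u) v = p u (H v)" and "s \<noteq> 0"
  shows "(cubic_model p h \<sigma> has_derivative
           p (gradient p h 0 + H s + (\<sigma> * ip_norm p s) *\<^sub>R s)) (at s)"
proof -
  have bl: "bounded_linear H" using H by (simp add: linear_linear)
  have dH: "(H has_derivative H) (at s)" using bl by (rule bounded_linear_imp_has_derivative)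
  have d2: "((\<lambda>v. p v (H v)) has_derivative (\<lambda>w. 2 * p (H s) w)) (at s)"
    by (rule has_derivative_eq_rhs[OF FDERIV[OF has_derivative_ident dH]])
       (simp add: fun_eq_iff sa[of s, symmetric] commute[of _ "H s"])
  have d1: "((\<lambda>v. p v (gradient p h 0)) has_derivative (\<lambda>w. p (gradient p h 0) w)) (at s)"
    by (rule has_derivative_eq_rhs[OF bounded_linear_imp_has_derivative[OF bounded_linear_left]])
       (rule ext, rule commute)
  have n: "ip_norm p s > 0" using \<open>s \<noteq> 0\<close> by (rule ip_norm_pos)
  have "((\<lambda>v. ip_norm p v ^ 3) has_derivative (\<lambda>w. 3 * ip_norm p s * p s w)) (at s)"
    by (rule has_derivative_eq_rhs[OF has_derivative_power[OF ip_norm_has_derivative[OF \<open>s \<noteq> 0\<close>]]])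
       (use n in \<open>simp add: fun_eq_iff power2_eq_square\<close>)
  then have "((\<lambda>v. h 0 + p v (gradient p h 0) + 1 / 2 * p v (H v) + \<sigma> / 3 * ip_norm p v ^ 3) has_derivative
      (\<lambda>w. 0 + p (gradient p h 0) w + 1 / 2 * (2 * p (H s) w) + \<sigma> / 3 * (3 * ip_norm p s * p s w))) (at s)"
    by (intro has_derivative_add has_derivative_const has_derivative_mult_right d1 d2)
  moreover have "cubic_model p h \<sigma> =
      (\<lambda>v. h 0 + p v (gradient p h 0) + 1 / 2 * p v (H v) + \<sigma> / 3 * ip_norm p v ^ 3)"
    by (rule ext) (simp add: cubic_model_def taylor2_def H_def)
  moreover have "p (gradient p h 0 + H s + (\<sigma> * ip_norm p s) *\<^sub>R s) =
      (\<lambda>w. 0 + p (gradient p h 0) w + 1 / 2 * (2 * p (H s) w) + \<sigma> / 3 * (3 * ip_norm p s * p s w))"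
    by (rule ext) (simp add: add_left scaleR_left)
  ultimately show ?thesis by simp
qed

lemma hessian_cubic_model:
  fixes h :: "'e \<Rightarrow> real" and \<sigma> :: real
  defines "H \<equiv> hessian p h 0"
  assumes H: "linear H" and sa: "\<And>u v. p (H u) v = p u (H v)" and s: "s \<noteq> 0"
  shows "hessian p (cubic_model p h \<sigma>) s =
           (\<lambda>w. H w + \<sigma> *\<^sub>R (ip_norm p s *\<^sub>R w + (p s w / ip_norm p s) *\<^sub>R s))"
proof -
  have bl: "bounded_linear H" using H by (simp add: linear_linear)
  have dH: "(H has_derivative H) (at s)" using bl by (rule bounded_linear_imp_has_derivative)
  have "((\<lambda>v. gradient p h 0 + H v + (\<sigma> * ip_norm p v) *\<^sub>R v) has_derivative
          (\<lambda>w. H w + \<sigma> *\<^sub>R (ip_norm p s *\<^sub>R w + (p s w / ip_norm p s) *\<^sub>R s))) (at s)"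
    by (auto intro!: derivative_eq_intros dH ip_norm_has_derivative s simp: fun_eq_iff algebra_simps)
  then have "(gradient p (cubic_model p h \<sigma>) has_derivative
      (\<lambda>w. H w + \<sigma> *\<^sub>R (ip_norm p s *\<^sub>R w + (p s w / ip_norm p s) *\<^sub>R s))) (at s)"
  \<comment> \<open>The gradient formula holds away from the origin, an open set that contains
    \<open>s\<close>.\<close>
  proof (rule has_derivative_transform_within_open[where s = "- {0}"])
    fix v :: 'e assume "v \<in> - {0}"
    then have "v \<noteq> 0" by simp
    then have "gradient p (cubic_model p h \<sigma>) v = gradient p h 0 + H v + (\<sigma> * ip_norm p v) *\<^sub>R v"
      using cubic_model_has_derivative[of h v \<sigma>] H sa unfolding H_def
      by (intro gradient_eqI) blast
    then show "gradient p h 0 + H v + (\<sigma> * ip_norm p v) *\<^sub>R v = gradient p (cubic_model p h \<sigma>) v" ..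
  qed (use s in auto)
  then show ?thesis unfolding hessian_def by (metis frechet_derivative_at)
qed

lemma lambda_min_hessian_cubic_model_le:
  fixes h :: "'e \<Rightarrow> real"
  assumes H: "linear (hessian p h 0)" and sa: "\<And>u v. p (hessian p h 0 u) v = p u (hessian p h 0 v)"
    and s: "s \<noteq> 0" and \<sigma>: "\<sigma> \<ge> 0"
  shows "lambda_min (hessian p (cubic_model p h \<sigma>) s) \<le> lambda_min (hessian p h 0) + 2 * \<sigma> * ip_norm p s"
proof -
  define H where "H = hessian p h 0"
  define T where "T = hessian p (cubic_model p h \<sigma>) s"
  define n where "n = ip_norm p s"
  have n: "n > 0" using s by (simp add: n_def ip_norm_pos)
  have T: "T = (\<lambda>w. H w + \<sigma> *\<^sub>R (n *\<^sub>R w + (p s w / n) *\<^sub>R s))"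
    unfolding T_def H_def n_def by (rule hessian_cubic_model[OF H sa s])
  have H: "linear H" and sa: "p (H u) v = p u (H v)" for u v
    using H sa by (simp_all add: H_def)
  have "linear T"
    unfolding T
    by (rule linearI) (simp_all add: linear_add[OF H] linear_cmul[OF H] add_right scaleR_right
        add_divide_distrib algebra_simps)
  moreover have "p (T u) v = p u (T v)" for u v
    by (simp add: T add_left add_right scaleR_left scaleR_right sa commute[of u s])
  ultimately have T_le: "lambda_min T * p v v \<le> p (T v) v" for v
    using lambda_min_selfadjoint by metis
  obtain v where v: "v \<noteq> 0" "H v = lambda_min H *\<^sub>R v"
    using lambda_min_selfadjoint[OF H sa] by metis
  \<comment> \<open>Cauchy-Schwarz bounds the rank-one part of the cubic term by its isotropic part;
    this is where the factor 2 arises.\<close>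
  have "(p s v)\<^sup>2 / n \<le> n * p v v"
    using Cauchy_Schwarz[of s v] n
    by (simp add: pos_divide_le_eq ip_norm_sq[of s, folded n_def, symmetric] power2_eq_square mult_ac)
  then have "\<sigma> * (n * p v v + (p s v)\<^sup>2 / n) \<le> \<sigma> * (2 * n * p v v)"
    using \<sigma> by (intro mult_left_mono) auto
  moreover have "p (T v) v = lambda_min H * p v v + \<sigma> * (n * p v v + (p s v)\<^sup>2 / n)"
    by (simp add: T v(2) add_left scaleR_left power2_eq_square)
  ultimately have "lambda_min T * p v v \<le> (lambda_min H + 2 * \<sigma> * n) * p v v"
    using T_le[of v] by (simp add: algebra_simps)
  then show ?thesis
    using pos[OF v(1)] by (simp add: T_def H_def n_def)
qed

end

section \<open>Pullbacks are twice differentiable near the origin\<close>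

text \<open>Exactly the regularity that \<open>hessian_selfadjoint\<close> asks for, at every point
  of \<open>S\<close>. The derivative is an existential witness, so that compositions can supply
  theirs explicitly.\<close>

definition twice_differentiable_on ::
  "'a::real_normed_vector set \<Rightarrow> ('a \<Rightarrow> 'b::real_normed_vector) \<Rightarrow> bool" where
  "twice_differentiable_on S f \<longleftrightarrow>
     (\<exists>f'. \<forall>y\<in>S. (f has_derivative f' y) (at y) \<and> (\<forall>v. (\<lambda>z. f' z v) differentiable (at y)))"

lemma twice_differentiable_on_transform:
  assumes "twice_differentiable_on S f" "open S" "\<And>y. y \<in> S \<Longrightarrow> f y = g y"
  shows "twice_differentiable_on S g"
  using assms(1) unfolding twice_differentiable_on_def
  by (metis has_derivative_transform_within_open assms(2,3))

lemma Ck_on_2_imp_twice_differentiable_on: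
  assumes "open S" "Ck_on 2 S f"
  shows "twice_differentiable_on S f"
proof -
  have "(f has_derivative frechet_derivative f (at y)) (at y)" if "y \<in> S" for y
    using assms that
    by (auto simp: numeral_2_eq_2 differentiable_on_eq_differentiable_at simp flip: frechet_derivative_works)
  moreover have "(\<lambda>x. frechet_derivative f (at x) v) differentiable (at y)" if "y \<in> S" for y v
    using assms that by (auto simp: numeral_2_eq_2 differentiable_on_eq_differentiable_at)
  ultimately show ?thesis
    unfolding twice_differentiable_on_def
    by (intro exI[of _ "\<lambda>y. frechet_derivative f (at y)"]) blast
qed

lemma twice_differentiable_on_Pair: "twice_differentiable_on S (\<lambda>v. (a, v))"
  unfolding twice_differentiable_on_def
  by (rule exI[of _ "\<lambda>_ v. (0, v)"]) (auto intro!: derivative_eq_intros)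

lemma twice_differentiable_on_compose:
  fixes \<phi> :: "'b::euclidean_space \<Rightarrow> 'c::real_normed_vector" and \<psi> :: "'a::real_normed_vector \<Rightarrow> 'b"
  assumes \<phi>: "twice_differentiable_on U \<phi>" and \<psi>: "twice_differentiable_on V \<psi>"
    and V: "open V" "\<psi> ` V \<subseteq> U"
  shows "twice_differentiable_on V (\<phi> \<circ> \<psi>)"
proof -
  obtain \<phi>' where \<phi>': "\<And>z. z \<in> U \<Longrightarrow> (\<phi> has_derivative \<phi>' z) (at z)"
      "\<And>z w. z \<in> U \<Longrightarrow> (\<lambda>z. \<phi>' z w) differentiable (at z)"
    using \<phi> unfolding twice_differentiable_on_def by blast
  obtain \<psi>' where \<psi>': "\<And>y. y \<in> V \<Longrightarrow> (\<psi> has_derivative \<psi>' y) (at y)"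
      "\<And>y v. y \<in> V \<Longrightarrow> (\<lambda>y. \<psi>' y v) differentiable (at y)"
    using \<psi> unfolding twice_differentiable_on_def by blast
  have "(\<lambda>y. \<phi>' (\<psi> y) (\<psi>' y v)) differentiable (at y)" if y: "y \<in> V" for y v
  proof -
    \<comment> \<open>In \<open>\<phi>' (\<psi> y) (\<psi>' y v)\<close> both the linear map and its
      argument move with \<open>y\<close>. Expanding the argument in a basis leaves a finite sum of
      products of differentiable functions.\<close>
    have eq: "(\<Sum>b\<in>Basis. (\<psi>' z v \<bullet> b) *\<^sub>R \<phi>' (\<psi> z) b) = \<phi>' (\<psi> z) (\<psi>' z v)" if "z \<in> V" for z
    proof -
      have "linear (\<phi>' (\<psi> z))" using \<phi>'(1) V that by (blast intro: has_derivative_linear)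
      then have "\<phi>' (\<psi> z) (\<Sum>b\<in>Basis. (\<psi>' z v \<bullet> b) *\<^sub>R b) = (\<Sum>b\<in>Basis. (\<psi>' z v \<bullet> b) *\<^sub>R \<phi>' (\<psi> z) b)"
        by (simp add: linear_sum linear_cmul)
      then show ?thesis by (simp add: euclidean_representation)
    qed
    have "(\<lambda>z. \<phi>' (\<psi> z) b) differentiable (at y)" for b
    proof -
      have "\<psi> differentiable (at y)" using \<psi>'(1)[OF y] by (rule differentiableI)
      moreover have "(\<lambda>z. \<phi>' z b) differentiable (at (\<psi> y))" using \<phi>'(2) V y by blast
      ultimately have "((\<lambda>z. \<phi>' z b) \<circ> \<psi>) differentiable (at y)"
        by (intro differentiable_chain_at)
      then show ?thesis by (simp add: o_def)
    qed
    then have "(\<lambda>z. \<Sum>b\<in>Basis. (\<psi>' z v \<bullet> b) *\<^sub>R \<phi>' (\<psi> z) b) differentiable (at y)"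
      using \<psi>'(2)[OF y, of v]
      by (intro differentiable_sum differentiable_scaleR differentiable_inner) auto
    then show ?thesis
      unfolding differentiable_def
      by (metis (no_types, lifting) has_derivative_transform_within_open[OF _ V(1) y] eq)
  qed
  moreover have "(\<phi> \<circ> \<psi> has_derivative (\<lambda>v. \<phi>' (\<psi> y) (\<psi>' y v))) (at y)" if "y \<in> V" for y
    using diff_chain_at[OF \<psi>'(1)[OF that] \<phi>'(1)] V that by (auto simp: o_def)
  ultimately show ?thesis
    unfolding twice_differentiable_on_def
    by (intro exI[of _ "\<lambda>y v. \<phi>' (\<psi> y) (\<psi>' y v)"]) blast
qed

lemma smooth_atlas_chart:
  assumes "smooth_atlas A" "c \<in> A"
  shows "open (snd c ` fst c)"
    and "y \<in> fst c \<Longrightarrow> chart_inv c (snd c y) = y"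
  using assms unfolding smooth_atlas_def homeomorphism_def by blast+

text \<open>The transition map is the identity on the open image of the chart. Hence the bundle
  chart induced by \<open>pc x\<close> leaves tangent vectors at \<open>x\<close> unchanged.\<close>

lemma coord_change_self:
  assumes A: "smooth_atlas A" "c \<in> A" and x: "x \<in> fst c"
  shows "coord_change c c x v = v"
proof -
  note c = smooth_atlas_chart[OF A]
  have "(snd c \<circ> chart_inv c has_derivative (\<lambda>v. v)) (at (snd c x))"
    by (rule has_derivative_transform_within_open[OF has_derivative_ident c(1)]) (use x c(2) in auto)
  from frechet_derivative_at[OF this, symmetric] show ?thesis
    by (simp add: coord_change_def)
qed

text \<open>Near 0 the pullback factors as \<open>v \<mapsto> (snd c x, v)\<close>, followed by the
  coordinate expression of the retraction and that of \<open>f\<close>, with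
  \<open>c = pc x\<close>. Each factor is twice differentiable.\<close>

lemma pullback_twice_differentiable:
  fixes A :: "('m::{t2_space, second_countable_topology}, 'e::euclidean_space) chart set"
  assumes A: "smooth_atlas A" and pc: "preferred_charts A pc"
    and R: "manifold_retraction A pc R" and f: "Ck_map 2 A euclidean_atlas f"
  obtains V where "open V" "0 \<in> V" "twice_differentiable_on V (pullback f R x)"
proof -
  define c where "c = pc x"
  have c: "c \<in> A" "x \<in> fst c" using pc by (auto simp: preferred_charts_def c_def)
  note chart = smooth_atlas_chart[OF A c(1)]
  define F where "F = (\<lambda>(x, v). R x v)"
  define C where "C = (\<lambda>(y, v). (snd c y, coord_change (pc y) c y v))"
  have C_in: "(fst c \<times> UNIV, C) \<in> tangent_atlas A pc"
    using c(1) by (auto simp: tangent_atlas_def C_def)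
  define W where "W = C ` (fst c \<times> UNIV \<inter> F -` fst c)"
  define \<Phi> where "\<Phi> = snd c \<circ> F \<circ> chart_inv (fst c \<times> UNIV, C)"
  have "open W" and \<Phi>: "twice_differentiable_on W \<Phi>"
  proof -
    have "Ck_map 2 (tangent_atlas A pc) A F"
      using R by (simp add: manifold_retraction_def smooth_map_def F_def)
    from this[unfolded Ck_map_def, rule_format, OF C_in c(1)]
    have "open W \<and> Ck_on 2 W \<Phi>"
      by (simp add: Let_def W_def \<Phi>_def)
    then show "open W" "twice_differentiable_on W \<Phi>"
      using Ck_on_2_imp_twice_differentiable_on by blast+
  qed
  have fc: "twice_differentiable_on (snd c ` fst c) (f \<circ> chart_inv c)"
    using f c(1) chart(1) unfolding Ck_map_def euclidean_atlas_def Let_def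
    by (intro Ck_on_2_imp_twice_differentiable_on) auto
  \<comment> \<open>The slice over \<open>x\<close> of the coordinate domain \<open>W\<close> of the
    retraction.\<close>
  define V where "V = (\<lambda>v. (snd c x, v)) -` W"
  have "open V" unfolding V_def
    using \<open>open W\<close> by (intro open_vimage continuous_intros)
  have C_x: "C (x, v) = (snd c x, v)" for v
    using coord_change_self[OF A c] by (simp add: C_def flip: c_def)
  \<comment> \<open>Injectivity of the bundle chart is established over \<open>x\<close> alone,
    where the fibre part is the identity. This determines the preimage that \<open>chart_inv\<close>
    selects.\<close>
  have C_eq: "C (y, u) = (snd c x, v) \<longleftrightarrow> y = x \<and> u = v" if "y \<in> fst c" for y u v
  proof
    assume eq: "C (y, u) = (snd c x, v)"
    then have "snd c y = snd c x" by (simp add: C_def)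
    then have "y = x" using chart(2) that c(2) by metis
    with eq C_x show "y = x \<and> u = v" by simp
  qed (simp add: C_x)
  have C_inv: "chart_inv (fst c \<times> UNIV, C) (snd c x, v) = (x, v)" for v
  proof -
    define z where "z = chart_inv (fst c \<times> UNIV, C) (snd c x, v)"
    have im: "(snd c x, v) \<in> C ` (fst c \<times> UNIV)"
      using C_eq[OF c(2), of v v] c(2) by (intro image_eqI[of _ _ "(x, v)"]) auto
    have "z \<in> fst c \<times> UNIV" "C z = (snd c x, v)"
      using inv_into_into[OF im] f_inv_into_f[OF im] by (simp_all add: z_def chart_inv_def)
    then have "z = (x, v)" using C_eq by (cases z) auto
    then show ?thesis by (simp add: z_def)
  qed
  have R_in: "R x v \<in> fst c" if "v \<in> V" for v
  proof -
    have "(snd c x, v) \<in> W" using that by (simp add: V_def)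
    then obtain y u where y: "y \<in> fst c" "R y u \<in> fst c" "(snd c x, v) = C (y, u)"
      unfolding W_def F_def by (elim imageE) auto
    from y(3)[symmetric] show ?thesis using C_eq[OF y(1)] y(2) by simp
  qed
  have "R x 0 = x" using R by (simp add: manifold_retraction_def)
  then have "0 \<in> V"
    using C_eq[OF c(2), of 0 0] c(2) unfolding V_def W_def F_def
    by (auto intro!: image_eqI[of _ _ "(x, 0)"])
  have \<Phi>_eq: "\<Phi> (snd c x, v) = snd c (R x v)" for v
    by (simp add: \<Phi>_def C_inv F_def)
  have "twice_differentiable_on V (\<Phi> \<circ> (\<lambda>v. (snd c x, v)))"
    using \<Phi> twice_differentiable_on_Pair \<open>open V\<close>
    by (rule twice_differentiable_on_compose) (auto simp: V_def)
  with fc have "twice_differentiable_on V ((f \<circ> chart_inv c) \<circ> (\<Phi> \<circ> (\<lambda>v. (snd c x, v))))"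
    using \<open>open V\<close> by (rule twice_differentiable_on_compose) (auto simp: \<Phi>_eq R_in)
  then have "twice_differentiable_on V (pullback f R x)"
    using \<open>open V\<close>
    by (rule twice_differentiable_on_transform) (simp add: \<Phi>_eq pullback_def chart(2) R_in)
  with that \<open>open V\<close> \<open>0 \<in> V\<close> show ?thesis by blast
qed

section \<open>The ARC iteration\<close>

text \<open>The manifold enters the analysis only through inner products, linear self-adjoint
  Hessians of the pullbacks at 0, and \<open>R y 0 = y\<close>.\<close>

locale arc_iteration =
  fixes g :: "'m \<Rightarrow> 'e::euclidean_space \<Rightarrow> 'e \<Rightarrow> real"
    and R :: "'m \<Rightarrow> 'e \<Rightarrow> 'm"
    and f :: "'m \<Rightarrow> real"
    and \<theta> \<sigma>min \<eta>1 \<eta>2 \<gamma>1 \<gamma>2 \<gamma>3 f_low L :: real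
    and x :: "nat \<Rightarrow> 'm" and s :: "nat \<Rightarrow> 'e" and \<sigma> :: "nat \<Rightarrow> real"
  assumes metric: "\<And>y. inner_product (g y)"
    and linear_hessian: "\<And>y. linear (hessian (g y) (pullback f R y) 0)"
    and selfadjoint_hessian: "\<And>y u v. g y (hessian (g y) (pullback f R y) 0 u) v =
                                 g y u (hessian (g y) (pullback f R y) 0 v)"
    and R_0: "\<And>y. R y 0 = y"
    and \<theta>: "\<theta> > 0" and \<sigma>min: "\<sigma>min > 0"
    and \<eta>: "0 < \<eta>1" "\<eta>1 \<le> \<eta>2" "\<eta>2 < 1"
    and \<gamma>: "1 < \<gamma>2" "\<gamma>2 < \<gamma>3"
    and run: "arc_run g R f \<theta> \<sigma>min \<eta>1 \<eta>2 \<gamma>1 \<gamma>2 \<gamma>3 x s \<sigma>"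
    and A1: "\<And>y. f y \<ge> f_low"
    and A2: "\<And>k. arc_reached s k \<Longrightarrow>
               pullback f R (x k) (s k) - taylor2 (g (x k)) (pullback f R (x k)) (s k)
                 \<le> L / 6 * ip_norm (g (x k)) (s k) ^ 3"
begin

definition step_norm :: "nat \<Rightarrow> real" where
  "step_norm k = ip_norm (g (x k)) (s k)"

definition ratio :: "nat \<Rightarrow> real" where
  "ratio k = arc_ratio g R f (x k) (s k) (\<sigma> k)"

definition successful :: "nat \<Rightarrow> bool" where
  "successful k \<longleftrightarrow> arc_successful g R f \<eta>1 x s \<sigma> k"

definition lam :: "nat \<Rightarrow> real" where
  "lam k = lambda_min (hessian (g (x k)) (pullback f R (x k)) 0)"

text \<open>This is the denominator of \<open>arc_ratio\<close>: the cubic term added there cancels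
  the one in the model.\<close>

definition predicted_decrease :: "nat \<Rightarrow> real" where
  "predicted_decrease k = f (x k) - taylor2 (g (x k)) (pullback f R (x k)) (s k)"

definition \<sigma>max :: real where
  "\<sigma>max = max (\<sigma> 0) (L * \<gamma>3 / (2 * (1 - \<eta>2)))"

lemma inner_product_space: "inner_product_space (g y)"
  by (simp add: inner_product_space_def metric)

lemma arc_reached_Suc: "arc_reached s (Suc k) \<longleftrightarrow> arc_reached s k \<and> s k \<noteq> 0"
  by (auto simp: arc_reached_def less_Suc_eq)

lemma successful_iff: "successful k \<longleftrightarrow> arc_reached s k \<and> s k \<noteq> 0 \<and> ratio k \<ge> \<eta>1"
  by (simp add: successful_def arc_successful_def ratio_def)

lemma \<sigma>_0: "\<sigma> 0 \<ge> \<sigma>min"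
  using run by (simp add: arc_run_def)

lemma subproblem:
  "arc_reached s k \<Longrightarrow>
     subproblem_step (g (x k)) \<theta> (cubic_model (g (x k)) (pullback f R (x k)) (\<sigma> k)) (s k)"
  using run by (simp add: arc_run_def)

lemma update:
  assumes "arc_reached s k" "s k \<noteq> 0"
  shows "x (Suc k) = (if ratio k \<ge> \<eta>1 then R (x k) (s k) else x k)"
    and "ratio k \<ge> \<eta>2 \<Longrightarrow> \<sigma>min \<le> \<sigma> (Suc k) \<and> \<sigma> (Suc k) \<le> \<sigma> k"
    and "\<eta>1 \<le> ratio k \<Longrightarrow> ratio k < \<eta>2 \<Longrightarrow> \<sigma> k \<le> \<sigma> (Suc k) \<and> \<sigma> (Suc k) \<le> \<gamma>2 * \<sigma> k"
    and "ratio k < \<eta>1 \<Longrightarrow> \<gamma>2 * \<sigma> k \<le> \<sigma> (Suc k) \<and> \<sigma> (Suc k) \<le> \<gamma>3 * \<sigma> k"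
  using run assms by (auto simp: arc_run_def ratio_def Let_def)

lemma step_norm_pos: "s k \<noteq> 0 \<Longrightarrow> step_norm k > 0"
  by (simp add: step_norm_def inner_product_space.ip_norm_pos[OF inner_product_space])

section \<open>Bounds on the regularisation parameter\<close>

lemma \<sigma>_ge: "arc_reached s k \<Longrightarrow> \<sigma> k \<ge> \<sigma>min"
proof (induction k)
  case 0
  show ?case by (rule \<sigma>_0)
next
  case (Suc k)
  then have k: "arc_reached s k" "s k \<noteq> 0" and IH: "\<sigma>min \<le> \<sigma> k" by (simp_all add: arc_reached_Suc)
  have "\<sigma> k \<le> \<gamma>2 * \<sigma> k" using IH \<sigma>min \<gamma> by simp
  with update(2-4)[OF k] IH show ?case by linarith
qed

lemma pullback_0: "pullback f R (x k) 0 = f (x k)"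
  by (simp add: pullback_def R_0)

lemma taylor2_0: "taylor2 (g (x k)) (pullback f R (x k)) 0 = f (x k)"
proof -
  interpret inner_product_space "g (x k)" by (rule inner_product_space)
  show ?thesis by (simp add: taylor2_def pullback_0 zero_left)
qed

lemma cubic_model_0: "cubic_model (g (x k)) (pullback f R (x k)) (\<sigma> k) 0 = f (x k)"
proof -
  interpret inner_product_space "g (x k)" by (rule inner_product_space)
  show ?thesis by (simp add: cubic_model_def taylor2_0)
qed

text \<open>The model decrease condition on the step, with the cubic term moved to the other
  side.\<close>

lemma predicted_decrease_ge:
  assumes "arc_reached s k"
  shows "predicted_decrease k \<ge> \<sigma> k / 3 * step_norm k ^ 3"
  using subproblem[OF assms] cubic_model_0[of k]
  by (simp add: subproblem_step_def predicted_decrease_def step_norm_def cubic_model_def)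

lemma predicted_decrease_pos:
  assumes "arc_reached s k" "s k \<noteq> 0"
  shows "predicted_decrease k > 0"
proof -
  have "0 < \<sigma> k / 3 * step_norm k ^ 3"
    using \<sigma>_ge[OF assms(1)] \<sigma>min step_norm_pos[OF assms(2)] by simp
  with predicted_decrease_ge[OF assms(1)] show ?thesis by linarith
qed

lemma ratio_eq: "ratio k = (f (x k) - f (R (x k) (s k))) / predicted_decrease k"
  using cubic_model_0[of k]
  by (simp add: ratio_def arc_ratio_def Let_def predicted_decrease_def cubic_model_def)

text \<open>By (A2) the actual decrease falls short of the predicted one by at most
  \<open>L / 6 * N\<close>, while the latter is at least \<open>\<sigma> k / 3 * N\<close>. The
  relative shortfall is thus at most \<open>1 - \<eta>2\<close>. The threshold is stated without
  division.\<close>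

lemma ratio_ge:
  assumes k: "arc_reached s k" "s k \<noteq> 0" and \<sigma>: "L \<le> 2 * \<sigma> k * (1 - \<eta>2)"
  shows "ratio k \<ge> \<eta>2"
proof -
  define N where "N = step_norm k ^ 3"
  have N: "N > 0" using step_norm_pos[OF k(2)] by (simp add: N_def)
  have "f (R (x k) (s k)) - f (x k) + predicted_decrease k \<le> L / 6 * N"
    using A2[OF k(1)] by (simp add: predicted_decrease_def pullback_def N_def step_norm_def)
  also have "\<dots> \<le> (2 * \<sigma> k * (1 - \<eta>2)) / 6 * N"
    using \<sigma> N by (intro mult_right_mono divide_right_mono) auto
  also have "\<dots> = (\<sigma> k / 3 * N) * (1 - \<eta>2)" by simp
  also have "\<dots> \<le> predicted_decrease k * (1 - \<eta>2)"
    using predicted_decrease_ge[OF k(1)] \<eta> by (intro mult_right_mono) (auto simp: N_def)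
  finally have "\<eta>2 * predicted_decrease k \<le> f (x k) - f (R (x k) (s k))"
    by (simp add: algebra_simps)
  then show ?thesis
    using predicted_decrease_pos[OF k] by (simp add: ratio_eq pos_le_divide_eq)
qed

text \<open>By \<open>ratio_ge\<close>, \<sigma> can increase only from below
  \<open>L / (2 * (1 - \<eta>2))\<close>, and then by a factor of at most \<gamma>3.\<close>

lemma \<sigma>_le: "arc_reached s k \<Longrightarrow> \<sigma> k \<le> \<sigma>max"
proof (induction k)
  case 0
  show ?case by (simp add: \<sigma>max_def)
next
  case (Suc k)
  then have k: "arc_reached s k" "s k \<noteq> 0" and IH: "\<sigma> k \<le> \<sigma>max" by (simp_all add: arc_reached_Suc)
  have pos: "\<sigma> k > 0" using \<sigma>_ge[OF k(1)] \<sigma>min by simp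
  show ?case
  proof (cases "L \<le> 2 * \<sigma> k * (1 - \<eta>2)")
    case True
    then show ?thesis using update(2)[OF k ratio_ge[OF k]] IH by simp
  next
    case False
    have "\<gamma>2 * \<sigma> k \<le> \<gamma>3 * \<sigma> k" "\<sigma> k \<le> \<gamma>3 * \<sigma> k"
      using pos \<gamma> by simp_all
    then have "\<sigma> (Suc k) \<le> \<gamma>3 * \<sigma> k"
      using update(2-4)[OF k] by linarith
    also have "\<dots> \<le> \<gamma>3 * (L / (2 * (1 - \<eta>2)))"
      using False \<gamma> \<eta> by (intro mult_left_mono) (auto simp: field_simps)
    also have "\<dots> \<le> \<sigma>max" by (simp add: \<sigma>max_def mult.commute)
    finally show ?thesis .
  qed
qed

lemma \<sigma>max_pos: "\<sigma>max > 0"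
  using \<sigma>_0 \<sigma>min by (simp add: \<sigma>max_def less_max_iff_disj)

section \<open>Decrease of \<open>f\<close> and the count of successful iterations\<close>

text \<open>A successful step realises at least the fraction \<eta>1 of the predicted decrease; an
  unsuccessful one keeps the iterate. The conditional form makes the estimate telescope over all
  iterations.\<close>

lemma f_decrease:
  assumes k: "arc_reached s k" "s k \<noteq> 0"
  shows "f (x (Suc k)) \<le> f (x k) - (if successful k then \<eta>1 * \<sigma>min / 3 * step_norm k ^ 3 else 0)"
proof (cases "ratio k \<ge> \<eta>1")
  case True
  have "\<eta>1 * \<sigma>min / 3 * step_norm k ^ 3 \<le> \<eta>1 * (\<sigma> k / 3 * step_norm k ^ 3)"
    using \<sigma>_ge[OF k(1)] \<eta> step_norm_pos[OF k(2)] by simp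
  also have "\<dots> \<le> \<eta>1 * predicted_decrease k"
    using predicted_decrease_ge[OF k(1)] \<eta> by simp
  also have "\<dots> \<le> f (x k) - f (R (x k) (s k))"
    using True predicted_decrease_pos[OF k] by (simp add: ratio_eq pos_le_divide_eq)
  finally show ?thesis using True k update(1)[OF k] by (simp add: successful_iff)
next
  case False
  then show ?thesis using update(1)[OF k] by (simp add: successful_iff)
qed

lemma sum_step_norm_le:
  "(\<Sum>k | k < K \<and> successful k. \<eta>1 * \<sigma>min / 3 * step_norm k ^ 3) \<le> f (x 0) - f_low"
proof -
  define S where "S K = (\<Sum>k<K. if successful k then \<eta>1 * \<sigma>min / 3 * step_norm k ^ 3 else 0)" for K
  \<comment> \<open>Once the algorithm has terminated, \<open>x K\<close> is unconstrained, but \<open>S\<close> no longer grows.\<close>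
  have "S K \<le> f (x 0) - f_low \<and> (arc_reached s K \<longrightarrow> S K \<le> f (x 0) - f (x K))"
  proof (induction K)
    case 0
    then show ?case using A1 by (simp add: S_def)
  next
    case (Suc K)
    show ?case
    proof (cases "arc_reached s K \<and> s K \<noteq> 0")
      case True
      then have "S (Suc K) \<le> f (x 0) - f (x (Suc K))"
        using Suc f_decrease[of K] by (simp add: S_def)
      then show ?thesis using A1[of "x (Suc K)"] by simp
    next
      case False
      then have "S (Suc K) = S K" by (auto simp: S_def successful_iff)
      with False Suc show ?thesis by (auto simp: arc_reached_Suc)
    qed
  qed
  moreover have "S K = (\<Sum>k | k < K \<and> successful k. \<eta>1 * \<sigma>min / 3 * step_norm k ^ 3)"
    unfolding S_def by (subst sum.inter_filter[symmetric]) auto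
  ultimately show ?thesis by simp
qed

text \<open>Chains the second-order condition on the step, the eigenvalue shift caused by the cubic
  term, and \<open>\<sigma>_le\<close>.\<close>

lemma lam_ge:
  assumes k: "arc_reached s k" "s k \<noteq> 0"
  shows "lam k \<ge> - (\<theta> + 2 * \<sigma>max) * step_norm k"
proof -
  interpret inner_product_space "g (x k)" by (rule inner_product_space)
  have "- \<theta> * step_norm k \<le> lambda_min (hessian (g (x k)) (cubic_model (g (x k)) (pullback f R (x k)) (\<sigma> k)) (s k))"
    using subproblem[OF k(1)] by (simp add: subproblem_step_def step_norm_def)
  also have "\<dots> \<le> lam k + 2 * \<sigma> k * step_norm k"
    unfolding lam_def step_norm_def
    using linear_hessian selfadjoint_hessian k(2) \<sigma>_ge[OF k(1)] \<sigma>min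
    by (intro lambda_min_hessian_cubic_model_le) auto
  also have "\<dots> \<le> lam k + 2 * \<sigma>max * step_norm k"
    using \<sigma>_le[OF k(1)] step_norm_pos[OF k(2)] by simp
  finally show ?thesis by (simp add: algebra_simps)
qed

lemma successful_count:
  assumes \<epsilon>: "\<epsilon> > 0"
  defines "N \<equiv> {k. successful k \<and> lam k < - \<epsilon>}"
  shows "finite N \<and> real (card N) \<le> 3 * (f (x 0) - f_low) / (\<eta>1 * \<sigma>min)
                                    * (\<theta> + 2 * \<sigma>max) ^ 3 * (1 / \<epsilon> ^ 3)"
proof -
  define B where "B = 3 * (f (x 0) - f_low) / (\<eta>1 * \<sigma>min) * (\<theta> + 2 * \<sigma>max) ^ 3 * (1 / \<epsilon> ^ 3)"
  define M where "M = \<theta> + 2 * \<sigma>max"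
  have M: "M > 0" using \<theta> \<sigma>max_pos by (simp add: M_def)
  define c where "c = \<eta>1 * \<sigma>min / 3"
  have c: "c > 0" using \<eta> \<sigma>min by (simp add: c_def)
  have long: "\<epsilon> / M \<le> step_norm k" if "k \<in> N" for k
  proof -
    have "\<epsilon> < M * step_norm k"
      using that lam_ge[of k] unfolding N_def mem_Collect_eq successful_iff M_def minus_mult_left
      by linarith
    then show ?thesis using M by (simp add: pos_divide_le_eq mult.commute)
  qed
  \<comment> \<open>Each member of \<open>N\<close> lowers \<open>f\<close> by at least
    \<open>c * (\<epsilon> / M) ^ 3\<close>. Only finite subsets can be summed over at first; their
    uniform cardinality bound then yields finiteness of \<open>N\<close>, and the bound for
    \<open>N\<close> itself.\<close>
  have bound: "real (card F) \<le> B" if F: "F \<subseteq> N" "finite F" for F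
  proof -
    obtain K where K: "F \<subseteq> {..<K}" using F(2) finite_nat_iff_bounded by blast
    have "real (card F) * (c * (\<epsilon> / M) ^ 3) = (\<Sum>k\<in>F. c * (\<epsilon> / M) ^ 3)" by simp
    also have "\<dots> \<le> (\<Sum>k\<in>F. c * step_norm k ^ 3)"
      using F(1) long c M \<epsilon> by (intro sum_mono mult_left_mono power_mono) auto
    also have "\<dots> \<le> (\<Sum>k | k < K \<and> successful k. c * step_norm k ^ 3)"
    proof (rule sum_mono2)
      show "F \<subseteq> {k. k < K \<and> successful k}" using F(1) K by (auto simp: N_def)
      fix k assume "k \<in> {k. k < K \<and> successful k} - F"
      then show "0 \<le> c * step_norm k ^ 3"
        using c step_norm_pos[of k] by (simp add: successful_iff)
    qed simp
    also have "\<dots> \<le> f (x 0) - f_low"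
      using sum_step_norm_le[of K] by (simp add: c_def)
    finally have "real (card F) \<le> (f (x 0) - f_low) / (c * (\<epsilon> / M) ^ 3)"
      using c M \<epsilon> by (simp add: pos_le_divide_eq)
    also have "\<dots> = B" by (simp add: B_def c_def M_def power_divide)
    finally show ?thesis .
  qed
  have "finite N \<and> card N \<le> nat \<lfloor>B\<rfloor>"
    by (rule finite_if_finite_subsets_card_bdd) (use bound in \<open>auto simp: le_nat_floor\<close>)
  then show ?thesis using bound[of N] by (simp add: B_def)
qed

section \<open>Infinitely many successes and the limit inferior\<close>

text \<open>If no success occurred from \<open>k\<close> on, \<sigma> would grow at least
  geometrically with factor \<gamma>2 > 1 and exceed \<open>\<sigma>max\<close>.\<close>

lemma ex_successful:
  assumes nonterminating: "\<And>k. s k \<noteq> 0"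
  shows "\<exists>j\<ge>k. successful j"
proof (rule ccontr)
  assume "\<not> ?thesis"
  then have none: "\<not> successful j" if "j \<ge> k" for j using that by blast
  have reached: "arc_reached s j" for j using nonterminating by (simp add: arc_reached_def)
  have "\<sigma> (k + i) \<ge> \<gamma>2 ^ i * \<sigma>min" for i
  proof (induction i)
    case 0
    then show ?case using \<sigma>_ge[OF reached] by simp
  next
    case (Suc i)
    have "ratio (k + i) < \<eta>1"
      using none[of "k + i"] reached nonterminating by (simp add: successful_iff)
    then have "\<gamma>2 * \<sigma> (k + i) \<le> \<sigma> (Suc (k + i))"
      using update(4)[OF reached nonterminating] by blast
    moreover have "\<gamma>2 * (\<gamma>2 ^ i * \<sigma>min) \<le> \<gamma>2 * \<sigma> (k + i)"
      using Suc \<gamma> by (intro mult_left_mono) auto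
    ultimately show ?case by simp
  qed
  then have "\<gamma>2 ^ i * \<sigma>min \<le> \<sigma>max" for i using \<sigma>_le[OF reached] order_trans by blast
  then have "\<gamma>2 ^ i \<le> \<sigma>max / \<sigma>min" for i using \<sigma>min by (simp add: pos_le_divide_eq)
  then show False using real_arch_pow[OF \<gamma>(1), of "\<sigma>max / \<sigma>min"] by (meson not_le)
qed

lemma liminf_lam_nonneg:
  assumes nonterminating: "\<And>k. s k \<noteq> 0"
  shows "0 \<le> liminf (\<lambda>k. ereal (lam k))"
proof -
  have reached: "arc_reached s j" for j using nonterminating by (simp add: arc_reached_def)
  have ev: "\<forall>\<^sub>F k in sequentially. lam k \<ge> - \<epsilon>" if \<epsilon>: "\<epsilon> > 0" for \<epsilon>
  proof -
    obtain K where K: "\<And>k. successful k \<Longrightarrow> lam k < - \<epsilon> \<Longrightarrow> k < K"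
      using successful_count[OF \<epsilon>] finite_nat_iff_bounded by auto
    have "lam k \<ge> - \<epsilon>" if "k \<ge> K" for k
    proof -
      \<comment> \<open>The first success at or after \<open>k\<close>. The iterate is constant from
        \<open>k\<close> to \<open>j\<close>, and \<open>lam\<close> depends on the iterate but not
        on \<sigma>, so the bound for successful iterations beyond \<open>K\<close> carries over to
        \<open>k\<close>.\<close>
      define j where "j = (LEAST j. j \<ge> k \<and> successful j)"
      have j: "j \<ge> k" "successful j"
        using LeastI_ex[OF ex_successful[OF nonterminating, of k, unfolded Bex_def]] by (auto simp: j_def)
      have "\<not> successful i" if "k \<le> i" "i < j" for i
        using not_less_Least[of i "\<lambda>j. j \<ge> k \<and> successful j"] that by (auto simp: j_def)
      then have stay: "x (Suc i) = x i" if "k \<le> i" "i < j" for i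
        using that update(1)[OF reached nonterminating, of i] reached nonterminating
        by (auto simp: successful_iff)
      have "x j = x k" using j(1) stay
      proof (induction rule: dec_induct)
        case (step n)
        then show ?case by simp
      qed simp
      then have "lam j = lam k" by (simp add: lam_def)
      then show ?thesis using K[OF j(2)] j(1) that by fastforce
    qed
    then show ?thesis unfolding eventually_sequentially by blast
  qed
  show ?thesis
    unfolding le_Liminf_iff
  proof (intro allI impI)
    fix y :: ereal assume "y < 0"
    \<comment> \<open>\<open>y\<close> may be minus infinity, so a real number between
      \<open>y\<close> and 0 supplies the \<epsilon>.\<close>
    then obtain r where r: "y < ereal r" "ereal r < 0" using ereal_dense2 by blast
    have "\<forall>\<^sub>F k in sequentially. lam k \<ge> - (- r)" using r(2) by (intro ev) simp
    then show "\<forall>\<^sub>F k in sequentially. y < ereal (lam k)"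
      by eventually_elim (use r(1) in \<open>auto intro: less_le_trans\<close>)
  qed
qed

end

section \<open>From the manifold hypotheses to the abstract iteration\<close>

theorem theorem5:
  fixes A :: "('m::{t2_space, second_countable_topology}, 'e::euclidean_space) chart set"
    and pc :: "'m \<Rightarrow> ('m, 'e) chart"
    and g :: "'m \<Rightarrow> 'e \<Rightarrow> 'e \<Rightarrow> real"
    and R :: "'m \<Rightarrow> 'e \<Rightarrow> 'm"
    and f :: "'m \<Rightarrow> real"
    and \<theta> \<sigma>min \<eta>1 \<eta>2 \<gamma>1 \<gamma>2 \<gamma>3 f_low L :: real
    and x :: "nat \<Rightarrow> 'm" and s :: "nat \<Rightarrow> 'e" and \<sigma> :: "nat \<Rightarrow> real"
  assumes "riemannian_manifold A pc g"
    and "manifold_retraction A pc R"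
    and "Ck_map 2 A euclidean_atlas f"
    and "\<theta> > 0" and "\<sigma>min > 0"
    and "0 < \<eta>1" and "\<eta>1 \<le> \<eta>2" and "\<eta>2 < 1"
    and "0 < \<gamma>1" and "\<gamma>1 < 1" and "1 < \<gamma>2" and "\<gamma>2 < \<gamma>3"
    and "arc_run g R f \<theta> \<sigma>min \<eta>1 \<eta>2 \<gamma>1 \<gamma>2 \<gamma>3 x s \<sigma>"
    and A1: "\<forall>y. f y \<ge> f_low"
    and A2: "\<forall>k. arc_reached s k \<longrightarrow>
               pullback f R (x k) (s k) - taylor2 (g (x k)) (pullback f R (x k)) (s k)
                 \<le> L / 6 * ip_norm (g (x k)) (s k) ^ 3"
  shows "(let \<sigma>max = max (\<sigma> 0) (L * \<gamma>3 / (2 * (1 - \<eta>2)));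
              lam = (\<lambda>k. lambda_min (hessian (g (x k)) (pullback f R (x k)) 0))
          in (\<forall>\<epsilon>>0.
                let N = {k. arc_successful g R f \<eta>1 x s \<sigma> k \<and> lam k < - \<epsilon>}
                in finite N \<and>
                   real (card N) \<le> 3 * (f (x 0) - f_low) / (\<eta>1 * \<sigma>min)
                                    * (\<theta> + 2 * \<sigma>max) ^ 3 * (1 / \<epsilon> ^ 3)) \<and>
             ((\<forall>k. s k \<noteq> 0) \<longrightarrow> 0 \<le> liminf (\<lambda>k. ereal (lam k))))"
proof -
  have atlas: "smooth_atlas A" "preferred_charts A pc"
    using assms(1) by (simp_all add: riemannian_manifold_def)
  have metric: "inner_product (g y)" for y
    using assms(1) by (simp add: riemannian_manifold_def riemannian_metric_def)
  have hess: "linear (hessian (g y) (pullback f R y) 0)"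
    "g y (hessian (g y) (pullback f R y) 0 u) v = g y u (hessian (g y) (pullback f R y) 0 v)" for y u v
  proof -
    \<comment> \<open>Smoothness of the retraction and the class of \<open>f\<close> provide a
      neighbourhood of the origin of the tangent space on which \<open>hessian_selfadjoint\<close>
      applies, at the point 0.\<close>
    obtain V where V: "open V" "0 \<in> V" "twice_differentiable_on V (pullback f R y)"
      by (rule pullback_twice_differentiable[OF atlas assms(2,3)])
    from V(2,3) obtain h' where "\<And>z. z \<in> V \<Longrightarrow> (pullback f R y has_derivative h' z) (at z)"
      "\<And>v. (\<lambda>z. h' z v) differentiable (at 0)"
      unfolding twice_differentiable_on_def by blast
    note * = inner_product_space.hessian_selfadjoint[OF inner_product_space.intro[OF metric] V(1,2) this]
    show "linear (hessian (g y) (pullback f R y) 0)" by (rule *(1))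
    show "g y (hessian (g y) (pullback f R y) 0 u) v = g y u (hessian (g y) (pullback f R y) 0 v)"
      by (rule *(2))
  qed
  have R_0: "R y 0 = y" for y using assms(2) by (simp add: manifold_retraction_def)
  interpret arc_iteration g R f \<theta> \<sigma>min \<eta>1 \<eta>2 \<gamma>1 \<gamma>2 \<gamma>3 f_low L x s \<sigma>
    by (intro arc_iteration.intro metric hess R_0 assms(4-8,11-13) A1[rule_format] A2[rule_format])
  show ?thesis
    using successful_count liminf_lam_nonneg
    unfolding Let_def successful_def lam_def \<sigma>max_def by simp
qed

end
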